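(* Let $\lambda_1,\lambda_2,\lambda_3\in\mathbb{R}$ and let $\mathrm{Im}(\mathbb{K})=T_{S_{\mathbb{K}}}(e)$ be the Lie algebra of the Lie group $S_{\mathbb{K}}$ of unit 3-parameter generalized quaternions, with Killing form $\mathcal{K}(X,Y)=\mathrm{tr}(Ad_X Ad_Y)$, where $Ad_X(Y)=[X,Y]$. Define $f:\mathrm{Im}(\mathbb{K})\times\mathrm{Im}(\mathbb{K})\to\mathbb{R}$ by $f(X,Y)=\lambda_1\lambda_2x_1y_1+\lambda_1\lambda_3x_2y_2+\lambda_2\lambda_3x_3y_3$ for $X=x_1e_1+x_2e_2+x_3e_3$ and $Y=y_1e_1+y_2e_2+y_3e_3$. Then $\mathcal{K}(X,Y)=-8f(X,Y)$ for all $X,Y\in\mathrm{Im}(\mathbb{K})$.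
   Context: Given $\lambda_1,\lambda_2,\lambda_3\in\mathbb{R}$, $\mathbb{K}$ is the (associative, unital) real algebra with vector-space basis $1,e_1,e_2,e_3$, unit $1$, and bilinear multiplication determined by $e_1^2=-\lambda_1\lambda_2$, $e_2^2=-\lambda_1\lambda_3$, $e_3^2=-\lambda_2\lambda_3$, $e_1e_2=\lambda_1e_3=-e_2e_1$, $e_2e_3=\lambda_3e_1=-e_3e_2$, $e_3e_1=\lambda_2e_2=-e_1e_3$. $S_{\mathbb{K}}=\{a_0+a_1e_1+a_2e_2+a_3e_3:a_0^2+\lambda_1\lambda_2a_1^2+\lambda_1\lambda_3a_2^2+\lambda_2\lambda_3a_3^2=1\}$ is a Lie group under this multiplication with Lie algebra $T_{S_{\mathbb{K}}}(e)=\mathrm{Im}(\mathbb{K})=\mathrm{span}\{e_1,e_2,e_3\}$, whose Lie bracket is the bilinear antisymmetric map with $[e_1,e_2]=2\lambda_1e_3$, $[e_2,e_3]=2\lambda_3e_1$, $[e_3,e_1]=2\lambda_2e_2$. *)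

theory Defs
  imports "HOL-Analysis.Analysis"
begin

section \<open>The algebra of 3-parameter generalized quaternions\<close>

text \<open>The vector \<open>a\<close> stands for \<open>a\<^sub>0 + a\<^sub>1 e\<^sub>1 + a\<^sub>2 e\<^sub>2 + a\<^sub>3 e\<^sub>3\<close>. The index type \<open>4\<close> has the elements
  \<open>0, 1, 2, 3\<close> (with \<open>4 = 0\<close>), so that \<open>a $ i\<close> is the coefficient \<open>a\<^sub>i\<close> and \<open>gq_e 0\<close> is the unit.\<close>

type_synonym gq = "real ^ 4"

definition gq_e :: "4 \<Rightarrow> gq" where
  "gq_e i = axis i 1"

definition gq_mult :: "real \<Rightarrow> real \<Rightarrow> real \<Rightarrow> gq \<Rightarrow> gq \<Rightarrow> gq" where
  "gq_mult l1 l2 l3 a b =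
     (a$0 * b$0 - l1 * l2 * (a$1 * b$1) - l1 * l3 * (a$2 * b$2) - l2 * l3 * (a$3 * b$3)) *\<^sub>R gq_e 0
   + (a$0 * b$1 + a$1 * b$0 + l3 * (a$2 * b$3 - a$3 * b$2)) *\<^sub>R gq_e 1
   + (a$0 * b$2 + a$2 * b$0 + l2 * (a$3 * b$1 - a$1 * b$3)) *\<^sub>R gq_e 2
   + (a$0 * b$3 + a$3 * b$0 + l1 * (a$1 * b$2 - a$2 * b$1)) *\<^sub>R gq_e 3"

definition gq_unit_sphere :: "real \<Rightarrow> real \<Rightarrow> real \<Rightarrow> gq set" where
  "gq_unit_sphere l1 l2 l3 =
     {a. (a$0)\<^sup>2 + l1 * l2 * (a$1)\<^sup>2 + l1 * l3 * (a$2)\<^sup>2 + l2 * l3 * (a$3)\<^sup>2 = 1}"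

definition gq_Im :: "gq set" where
  "gq_Im = span {gq_e 1, gq_e 2, gq_e 3}"

text \<open>The bilinear antisymmetric map with \<open>[e\<^sub>1,e\<^sub>2] = 2\<lambda>\<^sub>1e\<^sub>3\<close>, \<open>[e\<^sub>2,e\<^sub>3] = 2\<lambda>\<^sub>3e\<^sub>1\<close>, \<open>[e\<^sub>3,e\<^sub>1] = 2\<lambda>\<^sub>2e\<^sub>2\<close>.
  It is a total function on the algebra, ignoring real parts, but only matters on \<open>gq_Im\<close>.\<close>

definition gq_bracket :: "real \<Rightarrow> real \<Rightarrow> real \<Rightarrow> gq \<Rightarrow> gq \<Rightarrow> gq" where
  "gq_bracket l1 l2 l3 X Y =
     (2 * l3 * (X$2 * Y$3 - X$3 * Y$2)) *\<^sub>R gq_e 1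
   + (2 * l2 * (X$3 * Y$1 - X$1 * Y$3)) *\<^sub>R gq_e 2
   + (2 * l1 * (X$1 * Y$2 - X$2 * Y$1)) *\<^sub>R gq_e 3"

definition gq_form :: "real \<Rightarrow> real \<Rightarrow> real \<Rightarrow> gq \<Rightarrow> gq \<Rightarrow> real" where
  "gq_form l1 l2 l3 X Y = l1 * l2 * X$1 * Y$1 + l1 * l3 * X$2 * Y$2 + l2 * l3 * X$3 * Y$3"


section \<open>Tangent spaces, traces and Killing forms\<close>

text \<open>Velocities at \<open>p\<close> of curves that stay in \<open>S\<close> for small times.\<close>

definition tangent_space :: "'a::real_normed_vector set \<Rightarrow> 'a \<Rightarrow> 'a set" where
  "tangent_space S p =
     {v. \<exists>\<gamma> \<epsilon>. \<epsilon> > 0 \<and> (\<forall>t. \<bar>t\<bar> < \<epsilon> \<longrightarrow> \<gamma> t \<in> S) \<and> \<gamma> 0 = p \<and> (\<gamma> has_vector_derivative v) (at 0)}"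

text \<open>The trace of an endomorphism \<open>f\<close> of a finite-dimensional subspace \<open>L\<close>, computed in a basis of \<open>L\<close>;
  see \<open>trace_on_eq\<close> below for the independence of the basis.\<close>

definition trace_on :: "'a::real_vector set \<Rightarrow> ('a \<Rightarrow> 'a) \<Rightarrow> real" where
  "trace_on L f =
     (let B = (SOME B. independent B \<and> span B = L) in \<Sum>b\<in>B. representation B (f b) b)"

definition lie_Ad :: "('a \<Rightarrow> 'a \<Rightarrow> 'a) \<Rightarrow> 'a \<Rightarrow> 'a \<Rightarrow> 'a" where
  "lie_Ad br X = (\<lambda>Y. br X Y)"

definition killing_form :: "'a::real_vector set \<Rightarrow> ('a \<Rightarrow> 'a \<Rightarrow> 'a) \<Rightarrow> 'a \<Rightarrow> 'a \<Rightarrow> real" where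
  "killing_form L br X Y = trace_on L (lie_Ad br X \<circ> lie_Ad br Y)"


section \<open>Consistency of the definitions\<close>

lemma UNIV_4_gq: "(UNIV :: 4 set) = {0, 1, 2, 3}"
proof -
  have "(4::4) = 0" by simp
  then show ?thesis using UNIV_4 by auto
qed

lemma forall_4_gq: "(\<forall>i::4. P i) \<longleftrightarrow> P 0 \<and> P 1 \<and> P 2 \<and> P 3"
proof -
  have "(\<forall>i::4. P i) \<longleftrightarrow> (\<forall>i\<in>{0, 1, 2, 3}. P i)" using UNIV_4_gq by blast
  then show ?thesis by simp
qed

lemma gq_eq_iff: "(a::gq) = b \<longleftrightarrow> a$0 = b$0 \<and> a$1 = b$1 \<and> a$2 = b$2 \<and> a$3 = b$3"
  by (simp add: vec_eq_iff forall_4_gq)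

lemma gq_e_nth [simp]: "gq_e i $ j = (if j = i then 1 else 0)"
  by (simp add: gq_e_def axis_def)

lemma gq_mult_table:
  "gq_mult l1 l2 l3 (gq_e 0) a = a" "gq_mult l1 l2 l3 a (gq_e 0) = a"
  "gq_mult l1 l2 l3 (gq_e 1) (gq_e 1) = - (l1 * l2) *\<^sub>R gq_e 0"
  "gq_mult l1 l2 l3 (gq_e 2) (gq_e 2) = - (l1 * l3) *\<^sub>R gq_e 0"
  "gq_mult l1 l2 l3 (gq_e 3) (gq_e 3) = - (l2 * l3) *\<^sub>R gq_e 0"
  "gq_mult l1 l2 l3 (gq_e 1) (gq_e 2) = l1 *\<^sub>R gq_e 3" "gq_mult l1 l2 l3 (gq_e 2) (gq_e 1) = - l1 *\<^sub>R gq_e 3"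
  "gq_mult l1 l2 l3 (gq_e 2) (gq_e 3) = l3 *\<^sub>R gq_e 1" "gq_mult l1 l2 l3 (gq_e 3) (gq_e 2) = - l3 *\<^sub>R gq_e 1"
  "gq_mult l1 l2 l3 (gq_e 3) (gq_e 1) = l2 *\<^sub>R gq_e 2" "gq_mult l1 l2 l3 (gq_e 1) (gq_e 3) = - l2 *\<^sub>R gq_e 2"
  by (simp_all add: gq_eq_iff gq_mult_def)

lemma gq_mult_assoc: "gq_mult l1 l2 l3 (gq_mult l1 l2 l3 a b) c = gq_mult l1 l2 l3 a (gq_mult l1 l2 l3 b c)"
  by (simp add: gq_eq_iff gq_mult_def algebra_simps)

lemma bounded_bilinear_gq_mult: "bounded_bilinear (gq_mult l1 l2 l3)"
  by (subst bilinear_conv_bounded_bilinear [symmetric])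
    (auto simp: bilinear_def linear_iff gq_eq_iff gq_mult_def algebra_simps)

lemma gq_unit_sphere_mult:
  assumes "a \<in> gq_unit_sphere l1 l2 l3" "b \<in> gq_unit_sphere l1 l2 l3"
  shows "gq_mult l1 l2 l3 a b \<in> gq_unit_sphere l1 l2 l3"
proof -
  let ?N = "\<lambda>a::gq. (a$0)\<^sup>2 + l1 * l2 * (a$1)\<^sup>2 + l1 * l3 * (a$2)\<^sup>2 + l2 * l3 * (a$3)\<^sup>2"
  have "?N (gq_mult l1 l2 l3 a b) = ?N a * ?N b"
    by (simp add: gq_mult_def power2_eq_square algebra_simps)
  with assms show ?thesis by (simp add: gq_unit_sphere_def)
qed

definition gq_conj :: "gq \<Rightarrow> gq" where
  "gq_conj a = a$0 *\<^sub>R gq_e 0 - a$1 *\<^sub>R gq_e 1 - a$2 *\<^sub>R gq_e 2 - a$3 *\<^sub>R gq_e 3"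

lemma gq_unit_sphere_inverse:
  assumes "a \<in> gq_unit_sphere l1 l2 l3"
  shows "gq_conj a \<in> gq_unit_sphere l1 l2 l3"
    and "gq_mult l1 l2 l3 a (gq_conj a) = gq_e 0" "gq_mult l1 l2 l3 (gq_conj a) a = gq_e 0"
  using assms by (auto simp: gq_unit_sphere_def gq_eq_iff gq_mult_def gq_conj_def power2_eq_square algebra_simps)

lemma gq_one_in_unit_sphere: "gq_e 0 \<in> gq_unit_sphere l1 l2 l3"
  by (simp add: gq_unit_sphere_def)

lemma gq_Im_iff: "a \<in> gq_Im \<longleftrightarrow> a$0 = 0"
proof
  assume "a \<in> gq_Im"
  then show "a$0 = 0"
    unfolding gq_Im_def by (induction rule: span_induct_alt) auto
next
  assume "a$0 = 0"
  then have "a = a$1 *\<^sub>R gq_e 1 + a$2 *\<^sub>R gq_e 2 + a$3 *\<^sub>R gq_e 3"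
    by (simp add: gq_eq_iff)
  moreover have "\<dots> \<in> gq_Im"
    unfolding gq_Im_def by (intro span_add span_scale span_base) auto
  ultimately show "a \<in> gq_Im" by simp
qed

lemma tangent_space_gq_unit_sphere:
  "tangent_space (gq_unit_sphere l1 l2 l3) (gq_e 0) = gq_Im"
proof (intro equalityI subsetI)
  fix v assume "v \<in> tangent_space (gq_unit_sphere l1 l2 l3) (gq_e 0)"
  then obtain \<gamma> \<epsilon> where \<epsilon>: "\<epsilon> > 0" and S: "\<And>t. \<bar>t\<bar> < \<epsilon> \<Longrightarrow> \<gamma> t \<in> gq_unit_sphere l1 l2 l3"
    and 0: "\<gamma> 0 = gq_e 0" and d: "(\<gamma> has_vector_derivative v) (at 0)"
    unfolding tangent_space_def by blast
  define N where
    "N = (\<lambda>t. (\<gamma> t $ 0)\<^sup>2 + l1 * l2 * (\<gamma> t $ 1)\<^sup>2 + l1 * l3 * (\<gamma> t $ 2)\<^sup>2 + l2 * l3 * (\<gamma> t $ 3)\<^sup>2)"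
  have c: "((\<lambda>t. \<gamma> t $ i) has_real_derivative v $ i) (at 0)" for i
    using bounded_linear.has_vector_derivative [OF bounded_linear_vec_nth d, of i]
    by (simp add: has_real_derivative_iff_has_vector_derivative)
  have "(N has_real_derivative 2 * v $ 0) (at 0)"
    unfolding N_def by (auto intro!: derivative_eq_intros c simp: 0)
  moreover have "(N has_real_derivative 0) (at 0)"
  proof (rule has_field_derivative_transform_within [where f = "\<lambda>_. 1" and d = \<epsilon>])
    fix t :: real assume "dist t 0 < \<epsilon>"
    then show "1 = N t" using S [of t] by (simp add: N_def gq_unit_sphere_def)
  qed (use \<epsilon> in auto)
  ultimately have "2 * v $ 0 = 0" by (rule DERIV_unique)
  then show "v \<in> gq_Im" by (simp add: gq_Im_iff)
next
  fix v assume "v \<in> gq_Im"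
  then have v0: "v $ 0 = 0" by (simp add: gq_Im_iff)
  define n where "n = l1 * l2 * (v$1)\<^sup>2 + l1 * l3 * (v$2)\<^sup>2 + l2 * l3 * (v$3)\<^sup>2"
  define \<gamma> where "\<gamma> = (\<lambda>t::real. inverse (sqrt (1 + t\<^sup>2 * n)) *\<^sub>R (gq_e 0 + t *\<^sub>R v))"
  have "((\<lambda>t::real. 1 + t\<^sup>2 * n) \<longlongrightarrow> 1) (at 0)" by (auto intro!: tendsto_eq_intros)
  then have "\<forall>\<^sub>F t::real in at 0. 1 + t\<^sup>2 * n > 0" by (rule order_tendstoD) simp
  then obtain \<epsilon> where \<epsilon>: "\<epsilon> > 0" and pos: "\<And>t::real. t \<noteq> 0 \<Longrightarrow> \<bar>t\<bar> < \<epsilon> \<Longrightarrow> 1 + t\<^sup>2 * n > 0"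
    unfolding eventually_at by (auto simp: dist_real_def)
  have "\<gamma> t \<in> gq_unit_sphere l1 l2 l3" if "\<bar>t\<bar> < \<epsilon>" for t
  proof -
    have p: "1 + t\<^sup>2 * n > 0" using pos [of t] that by (cases "t = 0") auto
    have "(\<gamma> t$0)\<^sup>2 + l1 * l2 * (\<gamma> t$1)\<^sup>2 + l1 * l3 * (\<gamma> t$2)\<^sup>2 + l2 * l3 * (\<gamma> t$3)\<^sup>2
        = (inverse (sqrt (1 + t\<^sup>2 * n)))\<^sup>2 * (1 + t\<^sup>2 * n)"
      by (simp add: \<gamma>_def v0 power_mult_distrib) (simp add: n_def power_mult_distrib algebra_simps)
    also have "\<dots> = 1" using p by (simp add: power_inverse)
    finally show ?thesis by (simp add: gq_unit_sphere_def)
  qed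
  moreover have "\<gamma> 0 = gq_e 0" by (simp add: \<gamma>_def)
  moreover have "(\<gamma> has_vector_derivative v) (at 0)"
  proof -
    have "((\<lambda>t::real. inverse (sqrt (1 + t\<^sup>2 * n))) has_real_derivative 0) (at 0)"
      by (auto intro!: derivative_eq_intros)
    moreover have "((\<lambda>t::real. gq_e 0 + t *\<^sub>R v) has_vector_derivative v) (at 0)"
      by (auto intro!: derivative_eq_intros)
    ultimately show ?thesis
      unfolding \<gamma>_def using has_vector_derivative_scaleR by fastforce
  qed
  ultimately show "v \<in> tangent_space (gq_unit_sphere l1 l2 l3) (gq_e 0)"
    unfolding tangent_space_def using \<epsilon> by blast
qed

lemma gq_bracket_table:
  "gq_bracket l1 l2 l3 (gq_e 1) (gq_e 2) = (2 * l1) *\<^sub>R gq_e 3"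
  "gq_bracket l1 l2 l3 (gq_e 2) (gq_e 3) = (2 * l3) *\<^sub>R gq_e 1"
  "gq_bracket l1 l2 l3 (gq_e 3) (gq_e 1) = (2 * l2) *\<^sub>R gq_e 2"
  by (simp_all add: gq_eq_iff gq_bracket_def)

lemma bilinear_gq_bracket: "bilinear (gq_bracket l1 l2 l3)"
  by (auto simp: bilinear_def linear_iff gq_eq_iff gq_bracket_def algebra_simps)

lemma gq_bracket_antisym: "gq_bracket l1 l2 l3 Y X = - gq_bracket l1 l2 l3 X Y"
  by (simp add: gq_eq_iff gq_bracket_def algebra_simps)

lemma gq_bracket_in_Im: "gq_bracket l1 l2 l3 X Y \<in> gq_Im"
  by (simp add: gq_Im_iff gq_bracket_def)

lemma gq_bracket_jacobi:
  "gq_bracket l1 l2 l3 X (gq_bracket l1 l2 l3 Y Z) + gq_bracket l1 l2 l3 Y (gq_bracket l1 l2 l3 Z X)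
     + gq_bracket l1 l2 l3 Z (gq_bracket l1 l2 l3 X Y) = 0"
  by (simp add: gq_eq_iff gq_bracket_def algebra_simps)

lemma gq_bracket_commutator:
  "gq_bracket l1 l2 l3 X Y = gq_mult l1 l2 l3 X Y - gq_mult l1 l2 l3 Y X"
  by (simp add: gq_eq_iff gq_bracket_def gq_mult_def algebra_simps)

text \<open>The bracket is the one of the Lie group: it is the derivative at the unit of the adjoint action
  \<open>g \<mapsto> g Y g\<^sup>-\<^sup>1\<close>, where \<open>g\<^sup>-\<^sup>1\<close> is the conjugate of \<open>g\<close> by \<open>gq_unit_sphere_inverse\<close>.\<close>

lemma gq_bracket_Lie_group:
  assumes X: "X \<in> gq_Im" and 0: "\<gamma> 0 = gq_e 0" and d: "(\<gamma> has_vector_derivative X) (at 0)"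
  shows "((\<lambda>t. gq_mult l1 l2 l3 (gq_mult l1 l2 l3 (\<gamma> t) Y) (gq_conj (\<gamma> t)))
           has_vector_derivative gq_bracket l1 l2 l3 X Y) (at 0)"
proof -
  note bil = bounded_bilinear.has_vector_derivative [OF bounded_bilinear_gq_mult]
  have "linear gq_conj" by (auto simp: linear_iff gq_eq_iff gq_conj_def algebra_simps)
  then have "bounded_linear gq_conj" by (simp add: linear_conv_bounded_linear)
  from bounded_linear.has_vector_derivative [OF this d]
  have c: "((\<lambda>t. gq_conj (\<gamma> t)) has_vector_derivative gq_conj X) (at 0)" .
  have "gq_conj X = - X" "gq_conj (gq_e 0) = gq_e 0"
    using X by (simp_all add: gq_Im_iff gq_eq_iff gq_conj_def)
  then show ?thesis
    using bil [OF bil [OF d has_vector_derivative_const [of Y]] c, of l1 l2 l3 l1 l2 l3]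
    by (simp add: 0 gq_mult_table gq_bracket_commutator bounded_bilinear.zero_right [OF bounded_bilinear_gq_mult]
        bounded_bilinear.minus_right [OF bounded_bilinear_gq_mult])
qed

lemma trace_on_eq:
  fixes f :: "'a::real_vector \<Rightarrow> 'a"
  assumes ind: "independent B" and L: "span B = L" and fin: "finite B"
    and lin: "linear f" and im: "f ` L \<subseteq> L"
  shows "trace_on L f = (\<Sum>b\<in>B. representation B (f b) b)"
proof -
  define C where "C = (SOME C. independent C \<and> span C = L)"
  have C: "independent C" "span C = L"
    using someI [of "\<lambda>C. independent C \<and> span C = L" B] ind L by (auto simp: C_def)
  have "C \<subseteq> span B" using C L span_superset by blast
  then have finC: "finite C" using independent_span_bound [OF fin C(1)] by simp
  have fB: "f b \<in> L" if "b \<in> L" for b using im that by blast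
  have BL: "b \<in> L" if "b \<in> B" for b using that L span_base by blast
  have CL: "c \<in> L" if "c \<in> C" for c using that C span_base by blast
  have rC: "representation C (f c) c = (\<Sum>b\<in>B. representation B c b * representation C (f b) c)"
    if c: "c \<in> C" for c
  proof -
    have "c = (\<Sum>b\<in>B. representation B c b *\<^sub>R b)"
      using sum_representation_eq [OF ind _ fin order_refl, of c] CL [OF c] L by simp
    then have "f c = (\<Sum>b\<in>B. representation B c b *\<^sub>R f b)"
      by (metis (no_types, lifting) lin linear_scale linear_sum sum.cong)
    then have "representation C (f c) = representation C (\<Sum>b\<in>B. representation B c b *\<^sub>R f b)" by simp
    also have "\<dots> = (\<lambda>x. \<Sum>b\<in>B. representation C (representation B c b *\<^sub>R f b) x)"
      using C fB BL by (intro representation_sum) (auto intro: span_scale)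
    also have "\<dots> = (\<lambda>x. \<Sum>b\<in>B. representation B c b * representation C (f b) x)"
      using C fB BL by (intro ext sum.cong refl) (simp add: representation_scale)
    finally show ?thesis by simp
  qed
  have rB: "representation B (f b) b = (\<Sum>c\<in>C. representation B c b * representation C (f b) c)"
    if b: "b \<in> B" for b
  proof -
    have "f b = (\<Sum>c\<in>C. representation C (f b) c *\<^sub>R c)"
      using sum_representation_eq [OF C(1) _ finC order_refl, of "f b"] fB BL b C by simp
    then have "representation B (f b) = representation B (\<Sum>c\<in>C. representation C (f b) c *\<^sub>R c)" by simp
    also have "\<dots> = (\<lambda>x. \<Sum>c\<in>C. representation B (representation C (f b) c *\<^sub>R c) x)"
      using L CL ind by (intro representation_sum) (auto intro: span_scale)
    also have "\<dots> = (\<lambda>x. \<Sum>c\<in>C. representation C (f b) c * representation B c x)"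
      using L CL ind by (intro ext sum.cong refl) (simp add: representation_scale)
    finally show ?thesis by (simp add: mult.commute)
  qed
  have "trace_on L f = (\<Sum>c\<in>C. representation C (f c) c)"
    by (simp add: trace_on_def C_def Let_def)
  also have "\<dots> = (\<Sum>c\<in>C. \<Sum>b\<in>B. representation B c b * representation C (f b) c)"
    using rC by (rule sum.cong [OF refl])
  also have "\<dots> = (\<Sum>b\<in>B. \<Sum>c\<in>C. representation B c b * representation C (f b) c)"
    by (rule sum.swap)
  also have "\<dots> = (\<Sum>b\<in>B. representation B (f b) b)"
    using rB by (intro sum.cong refl) simp
  finally show ?thesis .
qed

end

theory Submission
  imports Defs
begin

text \<open>The tangent space at the unit is \<open>gq_Im\<close>, so a trace over it is the sum of the diagonal entries in
  the basis \<open>e\<^sub>1, e\<^sub>2, e\<^sub>3\<close> (\<open>trace_on_gq_Im\<close>). Both sides are bilinear in \<open>X\<close> and \<open>Y\<close>, so it is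
  enough to understand them on basis vectors. For \<open>i \<in> {1, 2, 3}\<close>, let \<open>c\<^sub>i\<close> be the coefficient of
  \<open>x\<^sub>i y\<^sub>i\<close> in \<open>gq_form\<close>, so \<open>c\<^sub>1 = \<lambda>\<^sub>1\<lambda>\<^sub>2\<close>, \<open>c\<^sub>2 = \<lambda>\<^sub>1\<lambda>\<^sub>3\<close> and \<open>c\<^sub>3 = \<lambda>\<^sub>2\<lambda>\<^sub>3\<close>. Bracketing with \<open>e\<^sub>i\<close> kills \<open>e\<^sub>i\<close>
  and sends each of the other two basis vectors to a multiple of the other. Bracketing twice therefore
  multiplies both of them by the same scalar, which is \<open>-4 c\<^sub>i\<close>. This gives trace \<open>-8 c\<^sub>i\<close>, and the
  factor \<open>8\<close> is \<open>2 * 4\<close>. Bracketing with \<open>e\<^sub>i\<close> and then with \<open>e\<^sub>j\<close> for \<open>i \<noteq> j\<close> sends every basis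
  vector to zero or to a multiple of a different basis vector, so mixed products contribute nothing.\<close>

lemma inj_gq_e: "gq_e i = gq_e j \<longleftrightarrow> i = j"
  by (simp add: gq_e_def axis_eq_axis)

lemma independent_gq_Im_basis: "independent {gq_e 1, gq_e 2, gq_e 3}"
  by (rule independent_mono [OF independent_Basis]) (auto simp: gq_e_def axis_in_Basis_iff)

lemma representation_gq_Im:
  assumes "v \<in> gq_Im" and "i \<in> {1, 2, 3}"
  shows "representation {gq_e 1, gq_e 2, gq_e 3} v (gq_e i) = v $ i"
proof -
  let ?B = "{gq_e 1, gq_e 2, gq_e 3}"
  have "(\<Sum>b\<in>?B. representation ?B v b *\<^sub>R b) = v"
    using assms(1) by (intro sum_representation_eq independent_gq_Im_basis) (auto simp: gq_Im_def)
  then have "v $ i = (\<Sum>b\<in>?B. representation ?B v b *\<^sub>R b) $ i"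
    by simp
  with assms(2) show ?thesis
    by (auto simp: inj_gq_e)
qed

text \<open>The diagonal entries can be read off as coordinates because the basis of \<open>gq_Im\<close> consists of
  standard unit vectors.\<close>

lemma trace_on_gq_Im:
  assumes "linear f" and "f ` gq_Im \<subseteq> gq_Im"
  shows "trace_on gq_Im f = f (gq_e 1) $ 1 + f (gq_e 2) $ 2 + f (gq_e 3) $ 3"
proof -
  let ?B = "{gq_e 1, gq_e 2, gq_e 3}"
  have "f (gq_e i) \<in> gq_Im" if "i \<in> {1, 2, 3}" for i
    using assms(2) that by (auto simp: gq_Im_iff image_subset_iff)
  moreover have "trace_on gq_Im f = (\<Sum>b\<in>?B. representation ?B (f b) b)"
    using assms by (intro trace_on_eq independent_gq_Im_basis) (auto simp: gq_Im_def)
  ultimately show ?thesis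
    by (simp add: inj_gq_e representation_gq_Im)
qed

lemma linear_lie_Ad: "bilinear br \<Longrightarrow> linear (lie_Ad br X)"
  by (simp add: bilinear_def lie_Ad_def)

theorem theorem5p7:
  fixes l1 l2 l3 :: real and X Y :: gq
  assumes "X \<in> tangent_space (gq_unit_sphere l1 l2 l3) (gq_e 0)"
    and "Y \<in> tangent_space (gq_unit_sphere l1 l2 l3) (gq_e 0)"
  shows "killing_form (tangent_space (gq_unit_sphere l1 l2 l3) (gq_e 0)) (gq_bracket l1 l2 l3) X Y
           = - 8 * gq_form l1 l2 l3 X Y"
proof -
  let ?br = "gq_bracket l1 l2 l3"
  let ?f = "lie_Ad ?br X \<circ> lie_Ad ?br Y"
  have "linear ?f"
    by (intro linear_compose linear_lie_Ad bilinear_gq_bracket)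
  moreover have "?f ` gq_Im \<subseteq> gq_Im"
    by (auto simp: lie_Ad_def gq_bracket_in_Im)
  ultimately have "trace_on gq_Im ?f = ?f (gq_e 1) $ 1 + ?f (gq_e 2) $ 2 + ?f (gq_e 3) $ 3"
    by (rule trace_on_gq_Im)
  also have "\<dots> = - 8 * gq_form l1 l2 l3 X Y"
    by (simp add: lie_Ad_def gq_bracket_def gq_form_def algebra_simps)
  finally show ?thesis
    by (simp add: killing_form_def tangent_space_gq_unit_sphere)
qed

end
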